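(* Let $\mathscr{H}$ be a reproducing kernel Hilbert space on a non-empty set $\mathscr{X}$, let $\theta\in[0,\frac{\pi}{2})$ and let $T\in\Pi^{\mathbf{Ber},P}_{\theta}$. Then for all $n\in\mathbb{N}$ (that is, $n=1,2,\dots$), $$\mathbf{ber}(T^n)\ \le\ (1+\sin^2\theta)^{n-1}\,\mathbf{ber}^n(T).$$
   Context: $\mathscr{H}$ is a complex separable reproducing kernel Hilbert space of complex-valued functions on a non-empty set $\mathscr{X}$: for every $\lambda\in\mathscr{X}$ evaluation at $\lambda$ is continuous, and $k_\lambda\in\mathscr{H}$ denotes the reproducing kernel, $\phi(\lambda)=\langle\phi,k_\lambda\rangle$ for all $\phi\in\mathscr{H}$. It is implicit that $k_\lambda\neq0$, and $\hat k_\lambda=k_\lambda/\|k_\lambda\|$. $\mathscr{B}(\mathscr{H})$ is the algebra of bounded linear operators on $\mathscr{H}$. For $A\in\mathscr{B}(\mathscr{H})$: $\Re(A)=\frac12(A+A^* )$, $\Im(A)=\frac1{2i}(A-A^* )$, $\Re^m(A)=(\Re(A))^m$, $\Im^m(A)=(\Im(A))^m$; the Berezin transform is $\widetilde A(\lambda)=\langle A\hat k_\lambda,\hat k_\lambda\rangle$; the Berezin range is $\mathbf{Ber}(A)=\{\widetilde A(\lambda):\lambda\in\mathscr{X}\}$; the Berezin number is $\mathbf{ber}(A)=\sup_{\lambda\in\mathscr{X}}|\widetilde A(\lambda)|$, and $\mathbf{ber}^m(A)=(\mathbf{ber}(A))^m$. For $\theta\in[0,\frac{\pi}{2})$, $S_\theta=\{z\in\mathbb{C}:|\arg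 z|\le\theta\}$ is the sector with vertex at the origin (vertex included) and semi-angle $\theta$; $\Pi^{\mathbf{Ber}}_\theta$ is the class of $A\in\mathscr{B}(\mathscr{H})$ with $\mathbf{Ber}(A)\subseteq S_\theta$; and $$\Pi^{\mathbf{Ber},P}_\theta=\{A\in\Pi^{\mathbf{Ber}}_\theta:\ \mathbf{ber}(\Re^m(A))\le\mathbf{ber}^m(\Re(A))\ \text{and}\ \mathbf{ber}(\Im^m(A))\le\mathbf{ber}^m(\Im(A))\ \text{for all } m\in\mathbb{N}\}.$$ *)

theory Defs
  imports "HOL-Analysis.Analysis" "HOL-Library.Function_Algebras"
begin

text \<open>
  The non-empty set on which the functions live is the universe of the type \<^typ>\<open>'x\<close>.
  A Hilbert space of functions is given by its carrier \<open>H\<close> and its inner product \<open>ip\<close>, linear in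
  the first argument; the values of \<open>ip\<close> and of operators outside \<open>H\<close> are irrelevant.
  Sums, differences and zero of functions are the pointwise ones from
  \<^theory>\<open>HOL-Library.Function_Algebras\<close>. That theory also makes \<open>^\<close> on functions a pointwise
  power, so powers of operators are always written with the iteration operator \<open>^^\<close>.
\<close>

type_synonym 'x cfun = "'x \<Rightarrow> complex"

definition cscale :: "complex \<Rightarrow> 'x cfun \<Rightarrow> 'x cfun"
  where "cscale c f = (\<lambda>x. c * f x)"

definition hnorm :: "('x cfun \<Rightarrow> 'x cfun \<Rightarrow> complex) \<Rightarrow> 'x cfun \<Rightarrow> real"
  where "hnorm ip f = sqrt (Re (ip f f))"

locale function_inner_product_space =
  fixes H :: "'x cfun set" and ip :: "'x cfun \<Rightarrow> 'x cfun \<Rightarrow> complex"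
  assumes zero_mem: "0 \<in> H"
    and add_mem: "f \<in> H \<Longrightarrow> g \<in> H \<Longrightarrow> f + g \<in> H"
    and scale_mem: "f \<in> H \<Longrightarrow> cscale c f \<in> H"
    and ip_add_left: "f \<in> H \<Longrightarrow> g \<in> H \<Longrightarrow> h \<in> H \<Longrightarrow> ip (f + g) h = ip f h + ip g h"
    and ip_scale_left: "f \<in> H \<Longrightarrow> g \<in> H \<Longrightarrow> ip (cscale c f) g = c * ip f g"
    and ip_commute: "f \<in> H \<Longrightarrow> g \<in> H \<Longrightarrow> ip f g = cnj (ip g f)"
    and ip_nonneg: "f \<in> H \<Longrightarrow> 0 \<le> Re (ip f f)"
    and ip_eq_zero: "f \<in> H \<Longrightarrow> ip f f = 0 \<Longrightarrow> f = 0"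

locale function_hilbert_space = function_inner_product_space H ip
  for H :: "'x cfun set" and ip :: "'x cfun \<Rightarrow> 'x cfun \<Rightarrow> complex" +
  assumes complete:
    "(\<And>n. s n \<in> H) \<Longrightarrow>
     (\<And>e. e > 0 \<Longrightarrow> \<exists>N. \<forall>m\<ge>N. \<forall>n\<ge>N. hnorm ip (s m - s n) < e) \<Longrightarrow>
     \<exists>l\<in>H. (\<lambda>n. hnorm ip (s n - l)) \<longlonglongrightarrow> 0"
    and separable:
    "\<exists>D\<subseteq>H. countable D \<and> (\<forall>f\<in>H. \<forall>e>0. \<exists>d\<in>D. hnorm ip (f - d) < e)"

text \<open>
  If evaluation at \<open>l\<close> is continuous, there is exactly one \<open>k\<close> as below, by the Riesz
  representation theorem.
\<close>

definition kernel :: "'x cfun set \<Rightarrow> ('x cfun \<Rightarrow> 'x cfun \<Rightarrow> complex) \<Rightarrow> 'x \<Rightarrow> 'x cfun"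
  where "kernel H ip l = (THE k. k \<in> H \<and> (\<forall>f\<in>H. f l = ip f k))"

locale rkhs = function_hilbert_space H ip
  for H :: "'x cfun set" and ip :: "'x cfun \<Rightarrow> 'x cfun \<Rightarrow> complex" +
  assumes evaluation_continuous:
    "f \<in> H \<Longrightarrow> e > 0 \<Longrightarrow> \<exists>d>0. \<forall>g\<in>H. hnorm ip (g - f) < d \<longrightarrow> cmod (g l - f l) < e"
    and kernel_nonzero: "kernel H ip l \<noteq> 0"

definition normalized_kernel ::
    "'x cfun set \<Rightarrow> ('x cfun \<Rightarrow> 'x cfun \<Rightarrow> complex) \<Rightarrow> 'x \<Rightarrow> 'x cfun"
  where "normalized_kernel H ip l =
    cscale (1 / of_real (hnorm ip (kernel H ip l))) (kernel H ip l)"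

definition bounded_operators ::
    "'x cfun set \<Rightarrow> ('x cfun \<Rightarrow> 'x cfun \<Rightarrow> complex) \<Rightarrow> ('x cfun \<Rightarrow> 'x cfun) set"
  where "bounded_operators H ip = {A.
    (\<forall>f\<in>H. A f \<in> H) \<and>
    (\<forall>f\<in>H. \<forall>g\<in>H. A (f + g) = A f + A g) \<and>
    (\<forall>c. \<forall>f\<in>H. A (cscale c f) = cscale c (A f)) \<and>
    (\<exists>C. \<forall>f\<in>H. hnorm ip (A f) \<le> C * hnorm ip f)}"

text \<open>
  For a bounded \<open>A\<close> on a Hilbert space and \<open>g \<in> H\<close>, the \<open>h\<close> below exists and is unique.
\<close>

definition adj ::
    "'x cfun set \<Rightarrow> ('x cfun \<Rightarrow> 'x cfun \<Rightarrow> complex) \<Rightarrow> ('x cfun \<Rightarrow> 'x cfun) \<Rightarrow> 'x cfun \<Rightarrow> 'x cfun"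
  where "adj H ip A g = (THE h. h \<in> H \<and> (\<forall>f\<in>H. ip (A f) g = ip f h))"

definition real_part ::
    "'x cfun set \<Rightarrow> ('x cfun \<Rightarrow> 'x cfun \<Rightarrow> complex) \<Rightarrow> ('x cfun \<Rightarrow> 'x cfun) \<Rightarrow> 'x cfun \<Rightarrow> 'x cfun"
  where "real_part H ip A f = cscale (1 / 2) (A f + adj H ip A f)"

definition imag_part ::
    "'x cfun set \<Rightarrow> ('x cfun \<Rightarrow> 'x cfun \<Rightarrow> complex) \<Rightarrow> ('x cfun \<Rightarrow> 'x cfun) \<Rightarrow> 'x cfun \<Rightarrow> 'x cfun"
  where "imag_part H ip A f = cscale (1 / (2 * \<i>)) (A f - adj H ip A f)"

definition berezin_transform ::
    "'x cfun set \<Rightarrow> ('x cfun \<Rightarrow> 'x cfun \<Rightarrow> complex) \<Rightarrow> ('x cfun \<Rightarrow> 'x cfun) \<Rightarrow> 'x \<Rightarrow> complex"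
  where "berezin_transform H ip A l =
    ip (A (normalized_kernel H ip l)) (normalized_kernel H ip l)"

definition berezin_range ::
    "'x cfun set \<Rightarrow> ('x cfun \<Rightarrow> 'x cfun \<Rightarrow> complex) \<Rightarrow> ('x cfun \<Rightarrow> 'x cfun) \<Rightarrow> complex set"
  where "berezin_range H ip A = range (berezin_transform H ip A)"

text \<open>
  The supremum is taken in the reals; for bounded \<open>A\<close> the set is non-empty and bounded by the
  operator norm.
\<close>

definition berezin_number ::
    "'x cfun set \<Rightarrow> ('x cfun \<Rightarrow> 'x cfun \<Rightarrow> complex) \<Rightarrow> ('x cfun \<Rightarrow> 'x cfun) \<Rightarrow> real"
  where "berezin_number H ip A = (SUP l. cmod (berezin_transform H ip A l))"

text \<open>The vertex belongs to the sector because \<open>Arg 0 = 0\<close>.\<close>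

definition sector :: "real \<Rightarrow> complex set"
  where "sector \<theta> = {z. \<bar>Arg z\<bar> \<le> \<theta>}"

definition berezin_sectorial ::
    "'x cfun set \<Rightarrow> ('x cfun \<Rightarrow> 'x cfun \<Rightarrow> complex) \<Rightarrow> real \<Rightarrow> ('x cfun \<Rightarrow> 'x cfun) set"
  where "berezin_sectorial H ip \<theta> =
    {A \<in> bounded_operators H ip. berezin_range H ip A \<subseteq> sector \<theta>}"

definition berezin_sectorial_power ::
    "'x cfun set \<Rightarrow> ('x cfun \<Rightarrow> 'x cfun \<Rightarrow> complex) \<Rightarrow> real \<Rightarrow> ('x cfun \<Rightarrow> 'x cfun) set"
  where "berezin_sectorial_power H ip \<theta> = {A \<in> berezin_sectorial H ip \<theta>.
    \<forall>m\<ge>1.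
      berezin_number H ip (real_part H ip A ^^ m) \<le> berezin_number H ip (real_part H ip A) ^ m \<and>
      berezin_number H ip (imag_part H ip A ^^ m) \<le> berezin_number H ip (imag_part H ip A) ^ m}"

end

theory Submission
  imports Defs
begin

text \<open>
  Let \<open>A\<close> and \<open>B\<close> be the real and imaginary parts of \<open>T\<close>, \<open>t = ber T\<close> and \<open>s = sin \<theta>\<close>; sectoriality
  gives \<open>ber A \<le> t\<close> and \<open>ber B \<le> s t\<close>. For a self-adjoint \<open>S\<close> with \<open>ber (S^m) \<le> (ber S)^m\<close> for all
  \<open>m\<close>, one has \<open>\<parallel>S^m k\<parallel> \<le> (ber S)^m\<close> on the normalised kernels. Since \<open>m \<mapsto> \<parallel>S^m f\<parallel>\<close> is
  log-convex, the vectors with \<open>\<parallel>S^m f\<parallel> = O((ber S)^m)\<close> form a closed subspace on which \<open>S\<close> is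
  bounded by \<open>ber S\<close>; it contains all kernels, so it is the whole space and \<open>\<parallel>S\<parallel> \<le> ber S\<close>.
  Hence \<open>\<parallel>A\<parallel> \<le> t\<close> and \<open>\<parallel>B\<parallel> \<le> s t\<close>, so the numerical radius of \<open>T\<close> is at most
  \<open>t sqrt (1 + s\<^sup>2)\<close>. By the power inequality for the numerical radius,
  \<open>ber (T^n) \<le> t^n (1 + s\<^sup>2)^(n/2)\<close>, and \<open>n/2 \<le> n - 1\<close> for \<open>n \<ge> 2\<close>.
\<close>

section \<open>Geometry of inner product spaces of functions\<close>

lemma cscale_apply [simp]: "cscale c f x = c * f x"
  by (simp add: cscale_def)

lemma sum_function_apply: "(\<Sum>i\<in>I. f i) x = (\<Sum>i\<in>I. f i x)"
  for f :: "'i \<Rightarrow> 'a \<Rightarrow> 'b::comm_monoid_add"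
  by (induction I rule: infinite_finite_induct) auto

context function_inner_product_space
begin

abbreviation nrm :: "'x cfun \<Rightarrow> real"
  where "nrm \<equiv> hnorm ip"

lemma diff_mem: assumes "f \<in> H" "g \<in> H" shows "f - g \<in> H"
proof -
  have "f + cscale (-1) g = f - g" by (rule ext) simp
  then show ?thesis using assms add_mem[of f "cscale (-1) g"] by (simp only: scale_mem)
qed

lemma sum_mem: "(\<And>i. i \<in> I \<Longrightarrow> f i \<in> H) \<Longrightarrow> (\<Sum>i\<in>I. f i) \<in> H"
  by (induction I rule: infinite_finite_induct) (auto simp: zero_mem add_mem)

lemma ip_add_right: assumes "f \<in> H" "g \<in> H" "h \<in> H" shows "ip f (g + h) = ip f g + ip f h"
  using assms by (metis add_mem complex_cnj_add ip_add_left ip_commute)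

lemma ip_scale_right: assumes "f \<in> H" "g \<in> H" shows "ip f (cscale c g) = cnj c * ip f g"
  using assms by (metis scale_mem complex_cnj_mult ip_scale_left ip_commute)

lemma ip_diff_left: assumes "f \<in> H" "g \<in> H" "h \<in> H" shows "ip (f - g) h = ip f h - ip g h"
  using ip_add_left[of "f - g" g h] assms by (simp add: diff_mem)

lemma ip_diff_right: assumes "f \<in> H" "g \<in> H" "h \<in> H" shows "ip f (g - h) = ip f g - ip f h"
  using ip_add_right[of f "g - h" h] assms by (simp add: diff_mem)

lemma ip_zero_left: "g \<in> H \<Longrightarrow> ip 0 g = 0"
  using ip_add_left[of 0 0 g] by (simp add: zero_mem)

lemma ip_zero_right: "g \<in> H \<Longrightarrow> ip g 0 = 0"
  using ip_add_right[of g 0 0] by (simp add: zero_mem)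

lemma ip_sum_right:
  assumes "f \<in> H" "\<And>i. i \<in> I \<Longrightarrow> g i \<in> H"
  shows "ip f (\<Sum>i\<in>I. g i) = (\<Sum>i\<in>I. ip f (g i))"
  using assms(2)
  by (induction I rule: infinite_finite_induct)
    (simp_all add: assms(1) ip_zero_right ip_add_right sum_mem)

lemma ip_self: assumes "f \<in> H" shows "ip f f = of_real ((nrm f)\<^sup>2)"
proof -
  have "Im (ip f f) = 0" using ip_commute[OF assms assms] by (metis cnj.simps(2) equal_neg_zero)
  then show ?thesis using ip_nonneg[OF assms] by (simp add: hnorm_def complex_eq_iff)
qed

lemma nrm_sq: "f \<in> H \<Longrightarrow> (nrm f)\<^sup>2 = Re (ip f f)"
  by (simp add: ip_self)

lemma nrm_nonneg: "f \<in> H \<Longrightarrow> 0 \<le> nrm f"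
  by (simp add: hnorm_def ip_nonneg)

lemma nrm_eq_0: assumes "f \<in> H" shows "nrm f = 0 \<longleftrightarrow> f = 0"
proof
  assume "nrm f = 0"
  then have "ip f f = 0" by (simp add: ip_self assms)
  then show "f = 0" using assms ip_eq_zero by simp
next
  assume "f = 0"
  then have "ip f f = 0" using ip_zero_left[OF zero_mem] by simp
  then show "nrm f = 0" by (simp add: hnorm_def)
qed

lemma nrm_scale: assumes "f \<in> H" shows "nrm (cscale c f) = cmod c * nrm f"
proof -
  have "ip (cscale c f) (cscale c f) = c * cnj c * ip f f"
    using assms by (simp add: ip_scale_left ip_scale_right scale_mem)
  also have "\<dots> = of_real ((cmod c * nrm f)\<^sup>2)"
    using assms by (simp add: ip_self power_mult_distrib flip: complex_norm_square)
  finally have "ip (cscale c f) (cscale c f) = of_real ((cmod c * nrm f)\<^sup>2)" .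
  then have "(nrm (cscale c f))\<^sup>2 = (cmod c * nrm f)\<^sup>2"
    by (simp add: nrm_sq assms scale_mem)
  then show ?thesis
    by (simp add: power2_eq_iff_nonneg nrm_nonneg scale_mem assms)
qed

lemma nrm_diff_commute: assumes "f \<in> H" "g \<in> H" shows "nrm (f - g) = nrm (g - f)"
proof -
  have "f - g = cscale (-1) (g - f)" by (rule ext) simp
  then show ?thesis by (simp add: nrm_scale diff_mem assms)
qed

lemma nrm_add_sq:
  assumes "f \<in> H" "g \<in> H"
  shows "(nrm (f + g))\<^sup>2 = (nrm f)\<^sup>2 + 2 * Re (ip g f) + (nrm g)\<^sup>2"
proof -
  have "Re (ip f g) = Re (ip g f)" using ip_commute[OF assms] by simp
  then show ?thesis using assms
    by (simp add: nrm_sq add_mem ip_add_left ip_add_right)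
qed

lemma cauchy_schwarz: assumes "f \<in> H" "g \<in> H" shows "cmod (ip f g) \<le> nrm f * nrm g"
proof (cases "nrm g = 0")
  case True
  then have "ip f g = 0" using nrm_eq_0[OF assms(2)] ip_zero_right[OF assms(1)] by simp
  then show ?thesis using True by simp
next
  case False
  define G where "G = (nrm g)\<^sup>2"
  have G: "G > 0" using False by (simp add: G_def)
  \<comment> \<open>This \<open>c\<close> makes \<open>f + cscale c g\<close> orthogonal to
    \<open>g\<close>; the inequality is the non-negativity of the squared norm of that
    vector.\<close>
  define c where "c = - (ip f g / of_real G)"
  have eq: "(nrm (f + cscale c g))\<^sup>2 = (nrm f)\<^sup>2 + 2 * Re (c * ip g f) + (cmod c)\<^sup>2 * G"
    using assms by (simp add: nrm_add_sq scale_mem nrm_scale ip_scale_left power_mult_distrib G_def)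
  have "c * ip g f = - (of_real ((cmod (ip f g))\<^sup>2) / of_real G)"
    using ip_commute[OF assms(2,1)] by (simp add: c_def flip: complex_norm_square)
  then have "Re (c * ip g f) = - ((cmod (ip f g))\<^sup>2 / G)"
    by (metis Re_complex_of_real of_real_divide of_real_minus)
  moreover have "(cmod c)\<^sup>2 * G = (cmod (ip f g))\<^sup>2 / G"
    using G by (simp add: c_def norm_divide power_divide power2_eq_square)
  ultimately have "0 \<le> (nrm f)\<^sup>2 - (cmod (ip f g))\<^sup>2 / G"
    using eq zero_le_power2[of "nrm (f + cscale c g)"] by linarith
  then have "(cmod (ip f g))\<^sup>2 \<le> (nrm f * nrm g)\<^sup>2"
    using G by (simp add: field_simps G_def)
  then show ?thesis
    by (rule power2_le_imp_le) (simp add: nrm_nonneg assms)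
qed

lemma nrm_triangle: assumes "f \<in> H" "g \<in> H" shows "nrm (f + g) \<le> nrm f + nrm g"
proof -
  have "Re (ip g f) \<le> nrm g * nrm f"
    using cauchy_schwarz[OF assms(2,1)] complex_Re_le_cmod[of "ip g f"] by linarith
  then have "(nrm (f + g))\<^sup>2 \<le> (nrm f + nrm g)\<^sup>2"
    using assms by (simp add: nrm_add_sq power2_sum mult.commute)
  then show ?thesis
    by (rule power2_le_imp_le) (simp add: nrm_nonneg assms)
qed

lemma nrm_le_add_diff: assumes "f \<in> H" "g \<in> H" shows "nrm f \<le> nrm g + nrm (f - g)"
  using nrm_triangle[of g "f - g"] assms by (simp add: diff_mem)

lemma parallelogram:
  assumes "f \<in> H" "g \<in> H"
  shows "(nrm (f + g))\<^sup>2 + (nrm (f - g))\<^sup>2 = 2 * (nrm f)\<^sup>2 + 2 * (nrm g)\<^sup>2"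
  using assms
  by (simp add: nrm_sq add_mem diff_mem ip_add_left ip_add_right ip_diff_left ip_diff_right)

text \<open>Closedness refers to the norm of \<open>ip\<close>, not to the pointwise topology of the
  function type, and is therefore spelled out with sequences.\<close>

definition closed_subspace :: "'x cfun set \<Rightarrow> bool"
  where "closed_subspace M \<longleftrightarrow> M \<subseteq> H \<and> 0 \<in> M \<and> (\<forall>f\<in>M. \<forall>g\<in>M. f + g \<in> M) \<and>
    (\<forall>c. \<forall>f\<in>M. cscale c f \<in> M) \<and>
    (\<forall>s. \<forall>l\<in>H. (\<forall>n. s n \<in> M) \<longrightarrow> (\<lambda>n. nrm (s n - l)) \<longlonglongrightarrow> 0 \<longrightarrow> l \<in> M)"

lemma eq_if_ip_eq:
  assumes "g \<in> H" "h \<in> H" "\<And>f. f \<in> H \<Longrightarrow> ip f g = ip f h"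
  shows "g = h"
proof -
  have "ip (g - h) (g - h) = 0" using assms by (simp add: ip_diff_right diff_mem)
  then show ?thesis using ip_eq_zero[of "g - h"] assms by (simp add: diff_mem)
qed

end

section \<open>Riesz representation and orthogonal projection\<close>

context function_hilbert_space
begin

lemma closed_subspace_carrier: "closed_subspace H"
  by (auto simp: closed_subspace_def zero_mem add_mem scale_mem)

text \<open>The representing vector minimises \<open>\<parallel>f\<parallel>\<^sup>2 - 2 Re (\<phi> f)\<close> over \<open>M\<close>.\<close>

lemma riesz_closed_subspace:
  assumes M: "closed_subspace M"
    and add: "\<And>f g. f \<in> M \<Longrightarrow> g \<in> M \<Longrightarrow> \<phi> (f + g) = \<phi> f + \<phi> g"
    and scale: "\<And>c f. f \<in> M \<Longrightarrow> \<phi> (cscale c f) = c * \<phi> f"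
    and bounded: "\<And>f. f \<in> M \<Longrightarrow> cmod (\<phi> f) \<le> C * nrm f"
  shows "\<exists>g\<in>M. \<forall>f\<in>M. \<phi> f = ip f g"
proof -
  define J where "J f = (nrm f)\<^sup>2 - 2 * Re (\<phi> f)" for f
  have MH: "\<And>f. f \<in> M \<Longrightarrow> f \<in> H" and M0: "0 \<in> M"
    and Madd: "\<And>f g. f \<in> M \<Longrightarrow> g \<in> M \<Longrightarrow> f + g \<in> M"
    and Mscale: "\<And>c f. f \<in> M \<Longrightarrow> cscale c f \<in> M"
    and Mclosed: "\<And>s l. l \<in> H \<Longrightarrow> (\<And>n. s n \<in> M) \<Longrightarrow> (\<lambda>n. nrm (s n - l)) \<longlonglongrightarrow> 0 \<Longrightarrow> l \<in> M"
    using M unfolding closed_subspace_def by blast+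
  have Mdiff: "f - g \<in> M" if "f \<in> M" "g \<in> M" for f g
  proof -
    have "f + cscale (-1) g = f - g" by (rule ext) simp
    then show ?thesis using that Madd[of f "cscale (-1) g"] by (simp only: Mscale)
  qed
  have phi_diff: "\<phi> (f - g) = \<phi> f - \<phi> g" if "f \<in> M" "g \<in> M" for f g
    using add[of "f - g" g] that Mdiff by simp
  \<comment> \<open>Completing the square bounds \<open>J\<close> from below, so its infimum over
    \<open>M\<close> is finite.\<close>
  have lower: "- (C\<^sup>2) \<le> J f" if "f \<in> M" for f
  proof -
    have "Re (\<phi> f) \<le> C * nrm f"
      using bounded[OF that] complex_Re_le_cmod[of "\<phi> f"] by linarith
    moreover have "0 \<le> (nrm f - C)\<^sup>2" by simp
    ultimately show ?thesis by (simp add: J_def power2_diff algebra_simps)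
  qed
  define d where "d = Inf (J ` M)"
  have bdd: "bdd_below (J ` M)" using lower by (auto intro!: bdd_belowI[of _ "- (C\<^sup>2)"])
  have d_le: "d \<le> J f" if "f \<in> M" for f
    unfolding d_def using bdd that by (simp add: cInf_lower)
  have "\<exists>f\<in>M. J f < d + 1 / real (Suc n)" for n
  proof -
    have "d < d + 1 / real (Suc n)" by simp
    then show ?thesis unfolding d_def using cInf_less_iff[of "J ` M"] bdd M0 by blast
  qed
  then obtain s where sM: "\<And>n. s n \<in> M" and sJ: "\<And>n. J (s n) < d + 1 / real (Suc n)"
    by metis
  \<comment> \<open>The midpoint \<open>h\<close> lies in \<open>M\<close>, so \<open>J h\<close> is
    at least \<open>d\<close>; the parallelogram law then makes every minimising sequence
    Cauchy.\<close>
  have dist: "(nrm (s m - s n))\<^sup>2 \<le> 2 / real (Suc m) + 2 / real (Suc n)" for m n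
  proof -
    define h where "h = cscale (1/2) (s m + s n)"
    have hM: "h \<in> M" by (simp add: h_def Mscale Madd sM)
    have "nrm (s m + s n) = 2 * nrm h"
      by (simp add: h_def nrm_scale add_mem MH sM)
    then have "4 * (nrm h)\<^sup>2 + (nrm (s m - s n))\<^sup>2 = 2 * (nrm (s m))\<^sup>2 + 2 * (nrm (s n))\<^sup>2"
      using parallelogram[of "s m" "s n"] by (simp add: MH sM power_mult_distrib)
    moreover have "Re (\<phi> h) = (Re (\<phi> (s m)) + Re (\<phi> (s n))) / 2"
      by (simp add: h_def scale add Madd sM)
    ultimately have "(nrm (s m - s n))\<^sup>2 = 2 * J (s m) + 2 * J (s n) - 4 * J h"
      by (simp add: J_def)
    then show ?thesis using sJ[of m] sJ[of n] d_le[OF hM] by simp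
  qed
  have "\<exists>l\<in>H. (\<lambda>n. nrm (s n - l)) \<longlonglongrightarrow> 0"
  proof (rule complete)
    show "s n \<in> H" for n by (simp add: MH sM)
    fix e :: real assume e: "e > 0"
    obtain N where N: "4 / e\<^sup>2 < real N" using reals_Archimedean2 by blast
    have "nrm (s m - s n) < e" if "m \<ge> N" "n \<ge> N" for m n
    proof -
      have *: "2 / real (Suc k) < e\<^sup>2 / 2" if "k \<ge> N" for k
      proof -
        have "4 / e\<^sup>2 < real (Suc k)" using N that by linarith
        then show ?thesis using e by (simp add: field_simps)
      qed
      have "(nrm (s m - s n))\<^sup>2 < e\<^sup>2"
        using dist[of m n] *[OF that(1)] *[OF that(2)] by linarith
      then show ?thesis using e by (simp add: power2_less_imp_less)
    qed
    then show "\<exists>N. \<forall>m\<ge>N. \<forall>n\<ge>N. nrm (s m - s n) < e" by blast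
  qed
  then obtain l where lH: "l \<in> H" and lim: "(\<lambda>n. nrm (s n - l)) \<longlonglongrightarrow> 0" by blast
  have lM: "l \<in> M" using Mclosed[OF lH sM lim] .
  have "(\<lambda>n. nrm (s n)) \<longlonglongrightarrow> nrm l"
  proof (rule LIM_zero_cancel, rule Lim_null_comparison[OF _ lim], rule always_eventually, rule allI)
    fix n
    show "norm (nrm (s n) - nrm l) \<le> nrm (s n - l)"
      using nrm_le_add_diff[of "s n" l] nrm_le_add_diff[of l "s n"] nrm_diff_commute[of "s n" l]
      by (simp add: MH sM lH abs_le_iff)
  qed
  moreover have "(\<lambda>n. \<phi> (s n)) \<longlonglongrightarrow> \<phi> l"
  proof (rule LIM_zero_cancel, rule Lim_null_comparison)
    show "(\<lambda>n. C * nrm (s n - l)) \<longlonglongrightarrow> 0" using tendsto_mult_right_zero[OF lim] .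
    show "\<forall>\<^sub>F n in sequentially. norm (\<phi> (s n) - \<phi> l) \<le> C * nrm (s n - l)"
      using bounded[OF Mdiff[OF sM lM]] by (simp add: phi_diff sM lM)
  qed
  ultimately have "(\<lambda>n. J (s n)) \<longlonglongrightarrow> J l"
    unfolding J_def by (intro tendsto_intros)
  moreover have "(\<lambda>n. d + 1 / real (Suc n)) \<longlonglongrightarrow> d + 0"
    by (intro tendsto_intros LIMSEQ_Suc[OF lim_1_over_n])
  ultimately have "J l \<le> d + 0"
    by (rule LIMSEQ_le) (use sJ less_imp_le in blast)
  then have Jl: "J l \<le> d" by simp
  have "\<phi> h = ip h l" if h: "h \<in> M" for h
  proof -
    define z where "z = ip h l - \<phi> h"
    \<comment> \<open>Moving from the minimiser \<open>l\<close> by \<open>cscale c h\<close>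
      changes \<open>J\<close> by 2 Re(c z) + |c|^2 |h|^2, where |h| is the norm. With
      \<open>c\<close> a small multiple of \<open>- cnj z\<close> this equals -e |z|^2 (2 - e
      |h|^2). The choice of \<open>e\<close> keeps e |h|^2 below 1, so minimality forces
      \<open>z = 0\<close>.\<close>
    define e where "e = 1 / (1 + (nrm h)\<^sup>2)"
    have e: "e > 0" "e * (nrm h)\<^sup>2 < 1"
      by (auto simp: e_def field_simps add_pos_nonneg)
    define c where "c = - (of_real e * cnj z)"
    have "J (l + cscale c h) = J l + 2 * Re (c * z) + (cmod c)\<^sup>2 * (nrm h)\<^sup>2"
      by (simp add: J_def nrm_add_sq lH MH[OF h] scale_mem add scale lM h Mscale ip_scale_left
          nrm_scale power_mult_distrib z_def algebra_simps)
    moreover have "c * z = of_real (- e * (cmod z)\<^sup>2)"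
      by (simp add: c_def mult.commute mult.left_commute flip: complex_norm_square)
    then have "Re (c * z) = - e * (cmod z)\<^sup>2" by (simp del: of_real_mult of_real_minus)
    moreover have "(cmod c)\<^sup>2 * (nrm h)\<^sup>2 = e * (cmod z)\<^sup>2 * (e * (nrm h)\<^sup>2)"
      using e by (simp add: c_def norm_mult power_mult_distrib power2_eq_square)
    moreover have "J l \<le> J (l + cscale c h)"
      using Jl d_le[of "l + cscale c h"] by (simp add: Madd Mscale lM h)
    ultimately have ineq: "2 * (e * (cmod z)\<^sup>2) \<le> e * (cmod z)\<^sup>2 * (e * (nrm h)\<^sup>2)"
      by simp
    have "e * (cmod z)\<^sup>2 * (e * (nrm h)\<^sup>2) \<le> e * (cmod z)\<^sup>2 * 1"
      using e by (intro mult_left_mono) auto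
    with ineq have "e * (cmod z)\<^sup>2 \<le> 0" by linarith
    then have "z = 0" using e by (simp add: mult_le_0_iff)
    then show ?thesis by (simp add: z_def)
  qed
  then show ?thesis using lM by blast
qed

text \<open>The functional taking \<open>g\<close> to \<open>ip g f\<close> is represented on
  \<open>M\<close> by some \<open>p\<close> in \<open>M\<close>, and this \<open>p\<close> is the
  projection of \<open>f\<close>.\<close>

lemma projection:
  assumes "closed_subspace M" "f \<in> H"
  shows "\<exists>p\<in>M. \<forall>g\<in>M. ip (f - p) g = 0"
proof -
  have MH: "\<And>g. g \<in> M \<Longrightarrow> g \<in> H" using assms(1) by (auto simp: closed_subspace_def)
  have "\<exists>p\<in>M. \<forall>g\<in>M. ip g f = ip g p"
    by (rule riesz_closed_subspace[OF assms(1), where C = "nrm f"])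
      (use assms(2) in \<open>auto simp: MH ip_add_left ip_scale_left mult.commute[of "nrm f"]
        intro!: cauchy_schwarz\<close>)
  then obtain p where p: "p \<in> M" "\<And>g. g \<in> M \<Longrightarrow> ip g f = ip g p" by blast
  have "ip (f - p) g = 0" if "g \<in> M" for g
    using p(2)[OF that] ip_commute[of f g] ip_commute[of p g] assms(2) MH[OF that] MH[OF p(1)]
    by (simp add: ip_diff_left)
  then show ?thesis using p(1) by blast
qed

section \<open>Bounded operators and adjoints\<close>

abbreviation bops :: "('x cfun \<Rightarrow> 'x cfun) set"
  where "bops \<equiv> bounded_operators H ip"

lemma
  assumes "A \<in> bops"
  shows bops_mem: "f \<in> H \<Longrightarrow> A f \<in> H"
    and bops_add: "f \<in> H \<Longrightarrow> g \<in> H \<Longrightarrow> A (f + g) = A f + A g"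
    and bops_scale: "f \<in> H \<Longrightarrow> A (cscale c f) = cscale c (A f)"
  using assms by (auto simp: bounded_operators_def)

lemma bops_bound:
  assumes "A \<in> bops"
  obtains C where "C \<ge> 0" "\<And>f. f \<in> H \<Longrightarrow> nrm (A f) \<le> C * nrm f"
proof -
  obtain C where C: "\<And>f. f \<in> H \<Longrightarrow> nrm (A f) \<le> C * nrm f"
    using assms unfolding bounded_operators_def by blast
  have "nrm (A f) \<le> \<bar>C\<bar> * nrm f" if "f \<in> H" for f
    using C[OF that] mult_right_mono[of C "\<bar>C\<bar>" "nrm f"] nrm_nonneg[OF that] by force
  then show thesis using that[of "\<bar>C\<bar>"] by simp
qed

lemma bopsI:
  assumes "\<And>f. f \<in> H \<Longrightarrow> A f \<in> H"
    and "\<And>f g. f \<in> H \<Longrightarrow> g \<in> H \<Longrightarrow> A (f + g) = A f + A g"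
    and "\<And>c f. f \<in> H \<Longrightarrow> A (cscale c f) = cscale c (A f)"
    and "\<And>f. f \<in> H \<Longrightarrow> nrm (A f) \<le> C * nrm f"
  shows "A \<in> bops"
  using assms unfolding bounded_operators_def by blast

lemma bops_zero: "A \<in> bops \<Longrightarrow> A 0 = 0"
  using bops_add[of A 0 0] by (simp add: zero_mem)

lemma bops_diff:
  assumes "A \<in> bops" "f \<in> H" "g \<in> H" shows "A (f - g) = A f - A g"
  using bops_add[of A "f - g" g] assms by (simp add: diff_mem)

lemma bops_sum:
  assumes "A \<in> bops" "\<And>i. i \<in> I \<Longrightarrow> f i \<in> H"
  shows "A (\<Sum>i\<in>I. f i) = (\<Sum>i\<in>I. A (f i))"
  using assms(2)
  by (induction I rule: infinite_finite_induct)
    (simp_all add: bops_zero[OF assms(1)] bops_add[OF assms(1)] sum_mem)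

lemma bops_lincomb:
  assumes A: "A \<in> bops" and B: "B \<in> bops"
  shows "(\<lambda>f. cscale c (A f) + cscale d (B f)) \<in> bops"
proof -
  obtain C where C: "C \<ge> 0" "\<And>f. f \<in> H \<Longrightarrow> nrm (A f) \<le> C * nrm f" using bops_bound[OF A] by metis
  obtain D where D: "D \<ge> 0" "\<And>f. f \<in> H \<Longrightarrow> nrm (B f) \<le> D * nrm f" using bops_bound[OF B] by metis
  show ?thesis
  proof (rule bopsI[where C = "cmod c * C + cmod d * D"])
    fix f assume f: "f \<in> H"
    have "nrm (cscale c (A f) + cscale d (B f)) \<le> cmod c * nrm (A f) + cmod d * nrm (B f)"
      using nrm_triangle[of "cscale c (A f)" "cscale d (B f)"] f
      by (simp add: scale_mem bops_mem[OF A] bops_mem[OF B] nrm_scale)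
    also have "\<dots> \<le> cmod c * (C * nrm f) + cmod d * (D * nrm f)"
      using f C D by (intro add_mono mult_left_mono) auto
    finally show "nrm (cscale c (A f) + cscale d (B f)) \<le> (cmod c * C + cmod d * D) * nrm f"
      by (simp add: algebra_simps)
  qed (auto simp: scale_mem add_mem bops_mem[OF A] bops_mem[OF B] bops_add[OF A] bops_add[OF B]
      bops_scale[OF A] bops_scale[OF B] fun_eq_iff algebra_simps)
qed

lemma bops_funpow: assumes A: "A \<in> bops" shows "A ^^ n \<in> bops"
proof (induction n)
  case 0
  show ?case by (rule bopsI[where C = 1]) auto
next
  case (Suc n)
  obtain C where C: "C \<ge> 0" "\<And>f. f \<in> H \<Longrightarrow> nrm (A f) \<le> C * nrm f" using bops_bound[OF A] by metis
  obtain D where D: "D \<ge> 0" "\<And>f. f \<in> H \<Longrightarrow> nrm ((A ^^ n) f) \<le> D * nrm f"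
    using bops_bound[OF Suc.IH] by metis
  show ?case
  proof (rule bopsI[where C = "C * D"])
    fix f assume f: "f \<in> H"
    have "nrm (A ((A ^^ n) f)) \<le> C * nrm ((A ^^ n) f)" using f C by (simp add: bops_mem[OF Suc.IH])
    also have "\<dots> \<le> C * (D * nrm f)" using f C D by (intro mult_left_mono) auto
    finally show "nrm ((A ^^ Suc n) f) \<le> C * D * nrm f" by (simp add: mult.assoc)
  qed (simp_all only: funpow.simps o_apply bops_mem[OF A] bops_mem[OF Suc.IH] bops_add[OF A]
      bops_add[OF Suc.IH] bops_scale[OF A] bops_scale[OF Suc.IH])
qed

text \<open>Riesz representation on the whole of \<open>H\<close>, applied to the functional taking
  \<open>f\<close> to \<open>ip (A f) g\<close>. This justifies the definite description in
  \<open>adj\<close>.\<close>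

lemma ex1_adj:
  assumes A: "A \<in> bops" and g: "g \<in> H"
  shows "\<exists>!h. h \<in> H \<and> (\<forall>f\<in>H. ip (A f) g = ip f h)"
proof -
  obtain C where C: "C \<ge> 0" "\<And>f. f \<in> H \<Longrightarrow> nrm (A f) \<le> C * nrm f" using bops_bound[OF A] by metis
  have "\<exists>h\<in>H. \<forall>f\<in>H. ip (A f) g = ip f h"
  proof (rule riesz_closed_subspace[OF closed_subspace_carrier, where C = "C * nrm g"])
    fix f assume f: "f \<in> H"
    have "cmod (ip (A f) g) \<le> nrm (A f) * nrm g" using f g by (simp add: cauchy_schwarz bops_mem[OF A])
    also have "\<dots> \<le> C * nrm f * nrm g"
      using C f g by (intro mult_right_mono) (auto simp: nrm_nonneg)
    finally show "cmod (ip (A f) g) \<le> C * nrm g * nrm f" by (simp add: mult_ac)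
  qed (use g in \<open>auto simp: bops_add[OF A] bops_scale[OF A] bops_mem[OF A] ip_add_left
      ip_scale_left\<close>)
  then show ?thesis using eq_if_ip_eq by (metis (no_types, lifting))
qed

abbreviation adjoint :: "('x cfun \<Rightarrow> 'x cfun) \<Rightarrow> 'x cfun \<Rightarrow> 'x cfun"
  where "adjoint \<equiv> adj H ip"

lemma
  assumes "A \<in> bops" "g \<in> H"
  shows adj_mem: "adjoint A g \<in> H"
    and ip_adj_right: "f \<in> H \<Longrightarrow> ip f (adjoint A g) = ip (A f) g"
  using theI'[OF ex1_adj[OF assms], folded adj_def] by auto

lemma ip_adj_left:
  assumes "A \<in> bops" "f \<in> H" "g \<in> H" shows "ip (adjoint A f) g = ip f (A g)"
  using ip_commute[of "adjoint A f" g] ip_commute[of f "A g"] assms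
  by (simp add: ip_adj_right adj_mem bops_mem[OF assms(1)])

lemma adj_bops: assumes A: "A \<in> bops" shows "adjoint A \<in> bops"
proof -
  obtain C where C: "C \<ge> 0" "\<And>f. f \<in> H \<Longrightarrow> nrm (A f) \<le> C * nrm f" using bops_bound[OF A] by metis
  show ?thesis
  proof (rule bopsI)
    show mem: "\<And>f. f \<in> H \<Longrightarrow> adjoint A f \<in> H" using A by (rule adj_mem)
    show "adjoint A (f + g) = adjoint A f + adjoint A g" if "f \<in> H" "g \<in> H" for f g
      by (rule eq_if_ip_eq) (use that A in \<open>simp_all add: adj_mem add_mem ip_adj_right ip_add_right
          bops_mem[OF A]\<close>)
    show "adjoint A (cscale c f) = cscale c (adjoint A f)" if "f \<in> H" for c f
      by (rule eq_if_ip_eq) (use that A in \<open>simp_all add: adj_mem scale_mem ip_adj_right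
          ip_scale_right bops_mem[OF A]\<close>)
    fix f assume f: "f \<in> H"
    define h where "h = adjoint A f"
    have h: "h \<in> H" using mem[OF f] by (simp add: h_def)
    \<comment> \<open>The squared norm of A* f is the inner product of A A* f with f, so one factor
      \<open>nrm h\<close> cancels and the bound \<open>C\<close> of \<open>A\<close> carries over
      to the adjoint.\<close>
    have "(nrm h)\<^sup>2 = Re (ip (A h) f)" using A f h by (simp add: nrm_sq h_def ip_adj_right)
    also have "\<dots> \<le> nrm (A h) * nrm f"
      using cauchy_schwarz[of "A h" f] complex_Re_le_cmod[of "ip (A h) f"] f h
      by (simp add: bops_mem[OF A])
    also have "\<dots> \<le> C * nrm h * nrm f"
      using C h f by (intro mult_right_mono) (auto simp: nrm_nonneg)
    finally have "nrm h * nrm h \<le> nrm h * (C * nrm f)" by (simp add: power2_eq_square mult_ac)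
    then have "nrm h \<le> C * nrm f"
      using nrm_nonneg[OF h] nrm_nonneg[OF f] C(1) by (cases "nrm h = 0") auto
    then show "nrm (adjoint A f) \<le> C * nrm f" by (simp add: h_def)
  qed
qed

section \<open>Symmetric operators and the Cartesian decomposition\<close>

lemma real_part_bops: assumes "A \<in> bops" shows "real_part H ip A \<in> bops"
proof -
  have "real_part H ip A = (\<lambda>f. cscale (1/2) (A f) + cscale (1/2) (adjoint A f))"
    by (simp add: fun_eq_iff real_part_def algebra_simps)
  then show ?thesis using bops_lincomb[OF assms adj_bops[OF assms]] by simp
qed

lemma imag_part_bops: assumes "A \<in> bops" shows "imag_part H ip A \<in> bops"
proof -
  have "imag_part H ip A = (\<lambda>f. cscale (1/(2*\<i>)) (A f) + cscale (-1/(2*\<i>)) (adjoint A f))"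
    by (simp add: fun_eq_iff imag_part_def algebra_simps)
  then show ?thesis using bops_lincomb[OF assms adj_bops[OF assms]] by simp
qed

definition symmetric_op :: "('x cfun \<Rightarrow> 'x cfun) \<Rightarrow> bool"
  where "symmetric_op S \<longleftrightarrow> S \<in> bops \<and> (\<forall>f\<in>H. \<forall>g\<in>H. ip (S f) g = ip f (S g))"

lemma symmetric_real_part: assumes A: "A \<in> bops" shows "symmetric_op (real_part H ip A)"
  unfolding symmetric_op_def
  by (auto simp: real_part_bops A) (simp add: real_part_def ip_scale_left ip_scale_right ip_add_left
      ip_add_right add_mem bops_mem[OF A] adj_mem[OF A] ip_adj_left[OF A] ip_adj_right[OF A]
      add.commute)

lemma symmetric_imag_part: assumes A: "A \<in> bops" shows "symmetric_op (imag_part H ip A)"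
  unfolding symmetric_op_def
  by (auto simp: imag_part_bops A) (simp add: imag_part_def ip_scale_left ip_scale_right ip_diff_left
      ip_diff_right diff_mem bops_mem[OF A] adj_mem[OF A] ip_adj_left[OF A] ip_adj_right[OF A]
      algebra_simps)

lemma symmetric_quadratic_real:
  assumes "symmetric_op S" "f \<in> H" shows "Im (ip (S f) f) = 0"
proof -
  have "S f \<in> H" "ip (S f) f = ip f (S f)"
    using assms bops_mem[of S f] unfolding symmetric_op_def by blast+
  then have "ip (S f) f = cnj (ip (S f) f)" using ip_commute[of "S f" f] assms(2) by simp
  then show ?thesis by (metis cnj.simps(2) equal_neg_zero)
qed

text \<open>\<open>A\<close> is its real part plus \<i> times its imaginary part, and the quadratic
  forms of these two symmetric operators are real.\<close>

lemma quadratic_cartesian: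
  assumes A: "A \<in> bops" and f: "f \<in> H"
  shows "Re (ip (A f) f) = Re (ip (real_part H ip A f) f)"
    and "Im (ip (A f) f) = Re (ip (imag_part H ip A f) f)"
proof -
  define R I where "R = real_part H ip A f" and "I = imag_part H ip A f"
  have mem: "R \<in> H" "I \<in> H"
    unfolding R_def I_def using f bops_mem[OF real_part_bops[OF A]] bops_mem[OF imag_part_bops[OF A]]
    by blast+
  have "A f = R + cscale \<i> I"
    by (rule ext) (simp add: R_def I_def real_part_def imag_part_def field_simps)
  then have "ip (A f) f = ip R f + \<i> * ip I f"
    using mem f by (simp add: ip_add_left ip_scale_left scale_mem)
  moreover have "Im (ip R f) = 0" "Im (ip I f) = 0"
    unfolding R_def I_def
    using A f by (simp_all add: symmetric_quadratic_real symmetric_real_part symmetric_imag_part)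
  ultimately show "Re (ip (A f) f) = Re (ip (real_part H ip A f) f)"
    "Im (ip (A f) f) = Re (ip (imag_part H ip A f) f)"
    by (simp_all add: R_def I_def)
qed

text \<open>Factors of \<open>S\<close> move across one at a time, which is why \<open>m\<close> is
  generalised in the induction. The lemma turns squared norms of powers into quadratic forms of even
  powers.\<close>

lemma symmetric_funpow:
  assumes "symmetric_op S" "f \<in> H" "g \<in> H"
  shows "ip ((S ^^ m) f) ((S ^^ n) g) = ip ((S ^^ (m + n)) f) g"
  using assms(3)
proof (induction n arbitrary: m g)
  case 0
  then show ?case by simp
next
  case (Suc n)
  have S: "S \<in> bops" using assms(1) by (simp add: symmetric_op_def)
  have mem: "(S ^^ k) h \<in> H" if "h \<in> H" for k h using bops_mem[OF bops_funpow[OF S]] that .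
  have "ip ((S ^^ m) f) ((S ^^ Suc n) g) = ip (S ((S ^^ m) f)) ((S ^^ n) g)"
    using assms(1) mem[OF assms(2)] mem[OF Suc.prems] by (simp add: symmetric_op_def)
  also have "\<dots> = ip ((S ^^ Suc m) f) ((S ^^ n) g)" by simp
  also have "\<dots> = ip ((S ^^ (m + Suc n)) f) g"
    using Suc.IH[OF Suc.prems, of "Suc m"] by simp
  finally show ?case .
qed

end

section \<open>Log-convex sequences and roots of unity\<close>

text \<open>Log-convexity makes successive ratios non-decreasing. A first ratio \<open>r\<close>
  above \<open>a\<close> would force growth at least like \<open>r ^ m\<close>, beating
  \<open>C * a ^ m\<close> whatever the constant \<open>C\<close>.\<close>

lemma log_convex_growth:
  fixes u :: "nat \<Rightarrow> real"
  assumes nonneg: "\<And>m. 0 \<le> u m" and convex: "\<And>m. (u (Suc m))\<^sup>2 \<le> u m * u (m + 2)"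
    and bound: "\<And>m. u m \<le> C * a ^ m" and a: "0 \<le> a"
  shows "u 1 \<le> a * u 0"
proof (rule ccontr)
  assume less: "\<not> u 1 \<le> a * u 0"
  \<comment> \<open>If \<open>u 0\<close> vanished, convexity at 0 would make \<open>u 1\<close>
    vanish too, contrary to \<open>less\<close>.\<close>
  have u0: "u 0 > 0"
  proof (rule ccontr)
    assume "\<not> u 0 > 0"
    then have "u 0 = 0" using nonneg[of 0] by simp
    then show False using convex[of 0] less by (simp add: power_le_zero_eq)
  qed
  define r where "r = u 1 / u 0"
  have r: "r > a" using less u0 by (simp add: r_def field_simps)
  have ratio: "r * u m \<le> u (Suc m)" for m
  proof (induction m)
    case 0
    then show ?case using u0 by (simp add: r_def)
  next
    case (Suc m)
    show ?case
    proof (cases "u (Suc m) = 0")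
      case False
      have "u m > 0"
        using convex[of m] False nonneg[of m] by (cases "u m = 0") auto
      have "u m * (r * u (Suc m)) = (r * u m) * u (Suc m)" by simp
      also have "\<dots> \<le> u (Suc m) * u (Suc m)" using Suc nonneg by (intro mult_right_mono)
      also have "\<dots> \<le> u m * u (Suc (Suc m))" using convex[of m] by (simp add: power2_eq_square)
      finally show ?thesis using \<open>u m > 0\<close> by simp
    qed (simp add: nonneg)
  qed
  have growth: "r ^ m * u 0 \<le> u m" for m
  proof (induction m)
    case (Suc m)
    have "r * (r ^ m * u 0) \<le> r * u m" using Suc r a by (intro mult_left_mono) auto
    then show ?case using ratio[of m] by (simp add: mult.assoc)
  qed simp
  have le: "r ^ m * u 0 \<le> C * a ^ m" for m using growth[of m] bound[of m] by linarith
  show False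
  proof (cases "a = 0")
    case True
    then show False using le[of 1] r u0 by (simp add: mult_le_0_iff)
  next
    case False
    then have a: "a > 0" using a by simp
    then have "1 < r / a" using r by simp
    then obtain m where m: "C / u 0 < (r / a) ^ m" using real_arch_pow by blast
    have "(r / a) ^ m \<le> C / u 0" using le[of m] a u0 by (simp add: power_divide field_simps)
    then show False using m by simp
  qed
qed

text \<open>A geometric sum whose ratio is an n-th root of unity different from 1 when 0 < m < n.
  Averaging over the roots thus extracts the term \<open>m = 0\<close> of a polynomial of degree
  below \<open>n\<close>.\<close>

lemma sum_root_unity_power:
  assumes "m < n"
  shows "(\<Sum>j<n. exp (2 * of_real pi * \<i> * of_nat j / of_nat n) ^ m) = (if m = 0 then of_nat n else (0::complex))"
proof (cases "m = 0")
  case False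
  define u :: complex where "u = exp (2 * of_real pi * \<i> * of_nat m / of_nat n)"
  have n: "n \<noteq> 0" using assms by simp
  have "u \<noteq> 1"
    unfolding u_def using complex_root_unity_eq_1[of n m] False assms by (auto dest: dvd_imp_le)
  moreover have "u ^ n = 1" unfolding u_def using complex_root_unity[OF n] .
  moreover have "exp (2 * of_real pi * \<i> * of_nat j / of_nat n) ^ m = u ^ j" for j
    unfolding u_def by (simp add: exp_of_nat_mult[symmetric] mult_ac)
  ultimately show ?thesis using False geometric_sum[of u n] by simp
qed simp

lemma ex_unimodular_power:
  assumes "n \<ge> 1" shows "\<exists>\<zeta>::complex. cmod \<zeta> = 1 \<and> \<zeta> ^ n * z = of_real (cmod z)"
proof (intro exI conjI)
  have "cis (- Arg z / real n) ^ n = cis (- Arg z)" using assms by (simp add: Complex.DeMoivre)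
  moreover have "z = of_real (cmod z) * cis (Arg z)" by (metis rcis_cmod_Arg rcis_def)
  ultimately show "cis (- Arg z / real n) ^ n * z = of_real (cmod z)"
    by (metis (no_types) cis_mult cis_zero mult.assoc mult.commute mult.right_neutral right_minus)
qed simp

section \<open>Power-bounded vectors and the numerical radius\<close>

context function_hilbert_space
begin

text \<open>By symmetry the squared norm of S^(m+1) f is the inner product of S^(m+2) f with S^m f.
  Cauchy-Schwarz then gives the log-convexity that removes the constant \<open>C\<close>.\<close>

lemma symmetric_norm_bound:
  assumes S: "symmetric_op S" and f: "f \<in> H" and a: "0 \<le> a"
    and bound: "\<And>m. nrm ((S ^^ m) f) \<le> C * a ^ m"
  shows "nrm (S f) \<le> a * nrm f"
proof -
  have "S \<in> bops" using S by (simp add: symmetric_op_def)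
  then have mem: "(S ^^ m) f \<in> H" for m using bops_mem[OF bops_funpow] f by blast
  have "(nrm ((S ^^ Suc m) f))\<^sup>2 \<le> nrm ((S ^^ m) f) * nrm ((S ^^ (m + 2)) f)" for m
  proof -
    have "(nrm ((S ^^ Suc m) f))\<^sup>2 = Re (ip ((S ^^ Suc m) f) ((S ^^ Suc m) f))"
      by (rule nrm_sq[OF mem])
    also have "\<dots> = Re (ip ((S ^^ (m + 2)) f) ((S ^^ m) f))"
      unfolding symmetric_funpow[OF S f f] by simp
    also have "\<dots> \<le> nrm ((S ^^ (m + 2)) f) * nrm ((S ^^ m) f)"
      using cauchy_schwarz[OF mem mem] complex_Re_le_cmod order_trans by blast
    finally show ?thesis by (simp only: mult.commute)
  qed
  then have "nrm ((S ^^ 1) f) \<le> a * nrm ((S ^^ 0) f)"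
    using a bound by (intro log_convex_growth[where u = "\<lambda>m. nrm ((S ^^ m) f)"])
      (auto simp: nrm_nonneg mem)
  then show ?thesis by simp
qed

lemma closed_subspace_power_bounded:
  assumes S: "symmetric_op S" and a: "0 \<le> a"
  shows "closed_subspace {f \<in> H. \<exists>C. \<forall>m. nrm ((S ^^ m) f) \<le> C * a ^ m}" (is "closed_subspace ?E")
proof -
  have B: "S ^^ m \<in> bops" for m using S by (simp add: symmetric_op_def bops_funpow)
  have mem: "(S ^^ m) f \<in> H" if "f \<in> H" for f m using bops_mem[OF B that] .
  \<comment> \<open>The individual constant \<open>C\<close> is replaced by \<open>nrm f\<close>:
    each S^m f again satisfies a growth bound, with constant \<open>C * a ^ m\<close>, so
    \<open>symmetric_norm_bound\<close> applies along the whole orbit. This uniform bound is what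
    survives sums and limits.\<close>
  have E: "nrm ((S ^^ m) f) \<le> nrm f * a ^ m" if "f \<in> ?E" for f m
  proof (induction m)
    case (Suc m)
    from that obtain C where f: "f \<in> H" and C: "\<And>m. nrm ((S ^^ m) f) \<le> C * a ^ m" by auto
    have "nrm (S ((S ^^ m) f)) \<le> a * nrm ((S ^^ m) f)"
    proof (rule symmetric_norm_bound[OF S mem[OF f] a, where C = "C * a ^ m"])
      show "nrm ((S ^^ k) ((S ^^ m) f)) \<le> C * a ^ m * a ^ k" for k
        using C[of "k + m"] by (simp add: funpow_add power_add mult_ac)
    qed
    also have "\<dots> \<le> a * (nrm f * a ^ m)" using Suc a by (rule mult_left_mono)
    finally show ?case by (simp add: mult_ac)
  qed simp
  have add: "f + g \<in> ?E" if "f \<in> ?E" "g \<in> ?E" for f g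
  proof -
    have H: "f \<in> H" "g \<in> H" using that by auto
    have "nrm ((S ^^ m) (f + g)) \<le> (nrm f + nrm g) * a ^ m" for m
      using nrm_triangle[OF mem mem, of f g m m] E[OF that(1), of m] E[OF that(2), of m] H
      by (simp add: bops_add[OF B] algebra_simps)
    then show ?thesis using H add_mem by blast
  qed
  have scale: "cscale c f \<in> ?E" if "f \<in> ?E" for c f
  proof -
    have H: "f \<in> H" using that by auto
    have "nrm ((S ^^ m) (cscale c f)) \<le> (cmod c * nrm f) * a ^ m" for m
      using mult_left_mono[OF E[OF that, of m], of "cmod c"] H
      by (simp add: bops_scale[OF B] nrm_scale mem mult.assoc)
    then show ?thesis using H scale_mem by blast
  qed
  have closed: "l \<in> ?E"
    if l: "l \<in> H" and s: "\<And>n. s n \<in> ?E" and lim: "(\<lambda>n. nrm (s n - l)) \<longlonglongrightarrow> 0" for s l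
  proof -
    have sH: "s n \<in> H" for n using s[of n] by simp
    have "nrm ((S ^^ m) l) \<le> nrm l * a ^ m" for m
    proof -
      \<comment> \<open>This operator bound may depend on \<open>m\<close>, because the limit in
        \<open>n\<close> is taken with \<open>m\<close> fixed.\<close>
      obtain C where C: "\<And>f. f \<in> H \<Longrightarrow> nrm ((S ^^ m) f) \<le> C * nrm f"
        using bops_bound[OF B[of m]] by metis
      have "nrm ((S ^^ m) l) \<le> (nrm l + nrm (s n - l)) * a ^ m + C * nrm (s n - l)" for n
      proof -
        have "nrm ((S ^^ m) l) \<le> nrm ((S ^^ m) (s n)) + nrm ((S ^^ m) (l - s n))"
          using nrm_le_add_diff[OF mem[OF l] mem[OF sH]] by (simp only: bops_diff[OF B] l sH)
        moreover have "nrm ((S ^^ m) (s n)) \<le> nrm (s n) * a ^ m" by (rule E[OF s])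
        moreover have "nrm (s n) * a ^ m \<le> (nrm l + nrm (s n - l)) * a ^ m"
          using nrm_le_add_diff[OF sH l] a by (intro mult_right_mono) auto
        moreover have "nrm ((S ^^ m) (l - s n)) \<le> C * nrm (s n - l)"
          using C[OF diff_mem[OF l sH]] by (simp only: nrm_diff_commute[OF l sH])
        ultimately show ?thesis by linarith
      qed
      moreover have "(\<lambda>n. (nrm l + nrm (s n - l)) * a ^ m + C * nrm (s n - l))
          \<longlonglongrightarrow> (nrm l + 0) * a ^ m + C * 0"
        by (intro tendsto_intros lim)
      ultimately show ?thesis
        using LIMSEQ_le_const by fastforce
    qed
    then show ?thesis using l by blast
  qed
  have "0 \<in> ?E"
    using zero_mem nrm_eq_0[OF zero_mem] by (auto simp: bops_zero[OF B] intro!: exI[of _ 0])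
  then show ?thesis
    unfolding closed_subspace_def using add scale closed by blast
qed

text \<open>
  Pearcy's argument: if \<open>c\<^sub>j\<close> runs through the \<open>n\<close>-th roots of a number and
  \<open>y\<^sub>j = (\<Sum>m<n. c\<^sub>j^m A^m x)\<close>, then \<open>(1 - c\<^sub>j A) y\<^sub>j = (1 - c\<^sub>j^n A^n) x\<close> does not depend
  on \<open>j\<close> and the \<open>y\<^sub>j\<close> add up to \<open>n x\<close>.
\<close>

lemma numerical_radius_power_pos:
  assumes A: "A \<in> bops" and w: "w > 0" and n: "n \<ge> 1" and x: "x \<in> H"
    and bound: "\<And>f. f \<in> H \<Longrightarrow> cmod (ip (A f) f) \<le> w * (nrm f)\<^sup>2"
  shows "cmod (ip ((A ^^ n) x) x) \<le> w ^ n * (nrm x)\<^sup>2"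
proof -
  define z where "z = ip ((A ^^ n) x) x"
  obtain \<zeta> where zeta: "cmod \<zeta> = 1" "\<zeta> ^ n * z = of_real (cmod z)"
    using ex_unimodular_power[OF n] by blast
  define rt :: "nat \<Rightarrow> complex" where "rt j = exp (2 * of_real pi * \<i> * of_nat j / of_nat n)" for j
  \<comment> \<open>Dividing by \<open>w\<close> gives \<open>c j\<close> modulus
    \<open>1 / w\<close>, matching the bound on the quadratic form. The phase \<open>\<zeta>\<close>
    makes \<open>q * z\<close> equal to the non-negative real \<open>cmod z / w ^ n\<close>, so that
    taking real parts loses nothing at the end.\<close>
  define c where "c j = \<zeta> / of_real w * rt j" for j
  define q where "q = (\<zeta> / of_real w) ^ n"
  define y where "y j = (\<Sum>m<n. cscale (c j ^ m) ((A ^^ m) x))" for j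
  define v where "v = x - cscale q ((A ^^ n) x)"
  have mem: "(A ^^ m) x \<in> H" for m using bops_mem[OF bops_funpow[OF A] x] .
  have yH: "y j \<in> H" for j unfolding y_def by (intro sum_mem scale_mem mem)
  have vH: "v \<in> H" unfolding v_def by (intro diff_mem scale_mem mem x)
  have c_pow: "c j ^ n = q" for j
    using n complex_root_unity[of n j]
    by (simp add: c_def q_def rt_def power_mult_distrib power_divide)
  have cmod_c: "cmod (c j) = 1 / w" for j
    using w zeta(1) by (simp add: c_def rt_def norm_mult norm_divide)
  have Ay: "A (y j) = (\<Sum>m<n. cscale (c j ^ m) ((A ^^ Suc m) x))" for j
    unfolding y_def by (simp add: bops_sum[OF A] scale_mem mem bops_scale[OF A])
  have v_eq: "v = y j - cscale (c j) (A (y j))" for j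
  proof
    fix t
    have "(y j - cscale (c j) (A (y j))) t
        = (\<Sum>m<n. c j ^ m * (A ^^ m) x t - c j ^ Suc m * (A ^^ Suc m) x t)"
      unfolding Ay unfolding y_def
      by (simp add: sum_function_apply sum_subtractf sum_distrib_left mult_ac)
    also have "\<dots> = x t - q * (A ^^ n) x t"
      by (subst sum_lessThan_telescope') (simp add: c_pow)
    finally show "v t = (y j - cscale (c j) (A (y j))) t" by (simp add: v_def)
  qed
  have sum_y: "(\<Sum>j<n. y j) = cscale (of_nat n) x"
  proof
    fix t
    have "(\<Sum>j<n. y j) t = (\<Sum>j<n. \<Sum>m<n. (\<zeta> / of_real w) ^ m * (A ^^ m) x t * rt j ^ m)"
      unfolding y_def c_def by (simp add: sum_function_apply power_mult_distrib power_divide mult_ac)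
    also have "\<dots> = (\<Sum>m<n. (\<zeta> / of_real w) ^ m * (A ^^ m) x t * (\<Sum>j<n. rt j ^ m))"
      by (subst sum.swap) (simp only: sum_distrib_left)
    also have "\<dots> = (\<Sum>m<n. if m = 0 then x t * of_nat n else 0)"
      unfolding rt_def by (intro sum.cong) (auto simp: sum_root_unity_power)
    also have "\<dots> = of_nat n * x t" using n by (simp add: sum.delta)
    finally show "(\<Sum>j<n. y j) t = cscale (of_nat n) x t" by simp
  qed
  \<comment> \<open>Here \<open>v\<close> is y_j - c_j A y_j, and the hypothesis bounds the real
    part of c_j <A y_j, y_j> by the squared norm of y_j. As \<open>v\<close> is the same for all
    \<open>j\<close>, these inequalities can be summed.\<close>
  have "0 \<le> Re (ip v (y j))" for j
  proof -
    have AyH: "A (y j) \<in> H" by (rule bops_mem[OF A yH])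
    have "ip v (y j) = ip (y j) (y j) - c j * ip (A (y j)) (y j)"
      unfolding v_eq[of j] by (simp add: ip_diff_left ip_scale_left scale_mem yH AyH)
    moreover have "Re (c j * ip (A (y j)) (y j)) \<le> (nrm (y j))\<^sup>2"
    proof -
      have "Re (c j * ip (A (y j)) (y j)) \<le> cmod (c j * ip (A (y j)) (y j))"
        by (rule complex_Re_le_cmod)
      also have "\<dots> = cmod (ip (A (y j)) (y j)) / w" by (simp add: norm_mult cmod_c)
      also have "\<dots> \<le> (nrm (y j))\<^sup>2" using bound[OF yH[of j]] w by (simp add: field_simps)
      finally show ?thesis .
    qed
    ultimately show ?thesis by (simp add: nrm_sq yH)
  qed
  then have "0 \<le> Re (\<Sum>j<n. ip v (y j))" by (simp add: sum_nonneg)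
  also have "(\<Sum>j<n. ip v (y j)) = ip v (\<Sum>j<n. y j)" by (simp add: ip_sum_right vH yH)
  also have "\<dots> = of_nat n * (ip x x - q * z)"
    by (simp add: sum_y ip_scale_right vH x v_def ip_diff_left ip_scale_left scale_mem mem z_def
        algebra_simps)
  also have "q * z = of_real (cmod z / w ^ n)"
    by (simp add: q_def power_divide zeta(2))
  finally have "0 \<le> real n * ((nrm x)\<^sup>2 - cmod z / w ^ n)"
    by (simp add: ip_self[OF x] flip: of_real_diff)
  then have "cmod z / w ^ n \<le> (nrm x)\<^sup>2" using n by (simp add: zero_le_mult_iff)
  then show ?thesis using w by (simp add: z_def field_simps)
qed

text \<open>The case \<open>w = 0\<close> is reached by applying the strict version to
  \<open>w + e\<close> and letting \<open>e\<close> tend to 0 from the right.\<close>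

lemma numerical_radius_power:
  assumes A: "A \<in> bops" and w: "w \<ge> 0" and n: "n \<ge> 1" and x: "x \<in> H"
    and bound: "\<And>f. f \<in> H \<Longrightarrow> cmod (ip (A f) f) \<le> w * (nrm f)\<^sup>2"
  shows "cmod (ip ((A ^^ n) x) x) \<le> w ^ n * (nrm x)\<^sup>2"
proof (rule tendsto_lowerbound)
  show "((\<lambda>e. (w + e) ^ n * (nrm x)\<^sup>2) \<longlongrightarrow> w ^ n * (nrm x)\<^sup>2) (at_right 0)"
    by (auto intro!: tendsto_eq_intros)
  have "cmod (ip ((A ^^ n) x) x) \<le> (w + e) ^ n * (nrm x)\<^sup>2" if "e > 0" for e
  proof (rule numerical_radius_power_pos[OF A _ n x])
    fix f assume "f \<in> H"
    then have "cmod (ip (A f) f) \<le> w * (nrm f)\<^sup>2" by (rule bound)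
    also have "\<dots> \<le> (w + e) * (nrm f)\<^sup>2" using that by (intro mult_right_mono) auto
    finally show "cmod (ip (A f) f) \<le> (w + e) * (nrm f)\<^sup>2" .
  qed (use w that in auto)
  then show "\<forall>\<^sub>F e in at_right 0. cmod (ip ((A ^^ n) x) x) \<le> (w + e) ^ n * (nrm x)\<^sup>2"
    by (auto simp: eventually_at_right_field intro: exI[of _ 1])
qed simp

end

section \<open>Reproducing kernels and the Berezin number\<close>

context rkhs
begin

lemma ex1_kernel: "\<exists>!k. k \<in> H \<and> (\<forall>f\<in>H. f l = ip f k)"
proof -
  obtain d where d: "d > 0" "\<And>g. g \<in> H \<Longrightarrow> nrm g < d \<Longrightarrow> cmod (g l) < 1"
    using evaluation_continuous[OF zero_mem zero_less_one, of l] by auto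
  have "\<exists>k\<in>H. \<forall>f\<in>H. f l = ip f k"
  proof (rule riesz_closed_subspace[OF closed_subspace_carrier, where C = "2 / d"])
    fix f assume f: "f \<in> H"
    show "cmod (f l) \<le> 2 / d * nrm f"
    proof (cases "nrm f = 0")
      case True
      then have "cmod (f l) = 0" using nrm_eq_0[OF f] by simp
      then show ?thesis using True by simp
    next
      case False
      then have pos: "nrm f > 0" using nrm_nonneg[OF f] by simp
      \<comment> \<open>Scaling \<open>f\<close> to norm \<open>d / 2\<close> puts it in the ball
        where evaluation is below 1; scaling back gives the constant \<open>2 / d\<close>.\<close>
      define c where "c = d / (2 * nrm f)"
      have c: "c > 0" using d(1) pos by (simp add: c_def)
      have "nrm (cscale (of_real c) f) = d / 2"
        unfolding nrm_scale[OF f] norm_of_real using pos d(1) by (simp add: c_def)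
      then have "cmod (cscale (of_real c) f l) < 1"
        using d(1) by (intro d(2) scale_mem f) linarith
      then have "c * cmod (f l) < 1" using c by (simp add: norm_mult)
      then show ?thesis using pos d(1) by (simp add: c_def field_simps)
    qed
  qed auto
  then show ?thesis using eq_if_ip_eq by (metis (no_types, lifting))
qed

lemma
  shows kernel_mem: "kernel H ip l \<in> H"
    and reproducing: "f \<in> H \<Longrightarrow> f l = ip f (kernel H ip l)"
  using theI'[OF ex1_kernel, folded kernel_def] by auto

abbreviation nk :: "'x \<Rightarrow> 'x cfun"
  where "nk \<equiv> normalized_kernel H ip"

lemma nrm_kernel_pos: "nrm (kernel H ip l) > 0"
  using nrm_nonneg[OF kernel_mem] nrm_eq_0[OF kernel_mem] kernel_nonzero[of l]
  by (simp add: less_le)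

lemma nk_mem: "nk l \<in> H"
  by (simp add: normalized_kernel_def scale_mem kernel_mem)

lemma nrm_nk: "nrm (nk l) = 1"
  using nrm_kernel_pos[of l]
  by (simp add: normalized_kernel_def nrm_scale kernel_mem norm_divide)

text \<open>Pairing with the kernel at \<open>l\<close> evaluates at \<open>l\<close>. So the
  kernels are total, which lets bounds spread from them to all of \<open>H\<close>.\<close>

lemma eq_zero_if_orthogonal_nk:
  assumes "f \<in> H" "\<And>l. ip f (nk l) = 0" shows "f = 0"
proof
  fix l
  have "ip f (kernel H ip l) = 0"
    using assms(2)[of l] nrm_kernel_pos[of l]
    by (simp add: normalized_kernel_def ip_scale_right assms(1) kernel_mem)
  then show "f l = 0 l" using reproducing[OF assms(1)] by simp
qed

text \<open>Boundedness of \<open>A\<close> bounds the set of moduli above, so the real supremum is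
  a genuine upper bound.\<close>

lemma berezin_le_number:
  assumes "A \<in> bops" shows "cmod (berezin_transform H ip A l) \<le> berezin_number H ip A"
proof -
  obtain C where C: "\<And>f. f \<in> H \<Longrightarrow> nrm (A f) \<le> C * nrm f" using bops_bound[OF assms] by metis
  have "cmod (berezin_transform H ip A l) \<le> C" for l
    using cauchy_schwarz[OF bops_mem[OF assms nk_mem[of l]] nk_mem[of l]] C[OF nk_mem[of l]]
    by (simp add: berezin_transform_def nrm_nk)
  then show ?thesis
    unfolding berezin_number_def by (intro cSUP_upper bdd_aboveI2) auto
qed

lemma berezin_number_leI:
  "(\<And>l. cmod (berezin_transform H ip A l) \<le> c) \<Longrightarrow> berezin_number H ip A \<le> c"
  unfolding berezin_number_def by (intro cSUP_least) auto

lemma berezin_number_nonneg: "A \<in> bops \<Longrightarrow> 0 \<le> berezin_number H ip A"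
  using berezin_le_number norm_ge_zero order_trans by blast

lemma symmetric_norm_le_berezin:
  assumes S: "symmetric_op S" and f: "f \<in> H"
    and pow: "\<And>m. m \<ge> 1 \<Longrightarrow> berezin_number H ip (S ^^ m) \<le> berezin_number H ip S ^ m"
  shows "nrm (S f) \<le> berezin_number H ip S * nrm f"
proof -
  define a where "a = berezin_number H ip S"
  define E where "E = {f \<in> H. \<exists>C. \<forall>m. nrm ((S ^^ m) f) \<le> C * a ^ m}"
  have B: "S \<in> bops" using S by (simp add: symmetric_op_def)
  have a: "a \<ge> 0" by (simp add: a_def berezin_number_nonneg B)
  have E: "closed_subspace E" unfolding E_def using S a by (rule closed_subspace_power_bounded)
  have "nrm ((S ^^ m) (nk l)) \<le> 1 * a ^ m" for l m
  proof (cases "m = 0")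
    case False
    have mem: "(S ^^ m) (nk l) \<in> H" by (rule bops_mem[OF bops_funpow[OF B] nk_mem])
    \<comment> \<open>On a normalised kernel the squared norm of S^m is the Berezin transform of
      S^(2m), so the hypothesis on powers applies with exponent \<open>m + m\<close>. The case
      \<open>m = 0\<close> is separate because that hypothesis starts at 1.\<close>
    have "(nrm ((S ^^ m) (nk l)))\<^sup>2 = Re (berezin_transform H ip (S ^^ (m + m)) l)"
      by (simp add: nrm_sq mem symmetric_funpow[OF S nk_mem nk_mem] berezin_transform_def)
    also have "\<dots> \<le> berezin_number H ip (S ^^ (m + m))"
      using berezin_le_number[OF bops_funpow[OF B]] complex_Re_le_cmod order_trans by blast
    also have "\<dots> \<le> a ^ (m + m)" unfolding a_def using False by (intro pow) simp
    also have "\<dots> = (a ^ m)\<^sup>2" by (simp add: power_add power2_eq_square)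
    finally have "nrm ((S ^^ m) (nk l)) \<le> a ^ m"
      by (rule power2_le_imp_le) (simp add: a)
    then show ?thesis by simp
  qed (simp add: nrm_nk)
  then have nkE: "nk l \<in> E" for l unfolding E_def using nk_mem by blast
  \<comment> \<open>Since \<open>E\<close> contains every normalised kernel, \<open>f - p\<close> is
    orthogonal to all of them and vanishes; hence \<open>f\<close> lies in \<open>E\<close>.\<close>
  obtain p where p: "p \<in> E" "\<And>g. g \<in> E \<Longrightarrow> ip (f - p) g = 0" using projection[OF E f] by blast
  have "f - p = 0"
    by (rule eq_zero_if_orthogonal_nk) (use p f nkE in \<open>auto simp: E_def intro: diff_mem\<close>)
  then have "f \<in> E" using p(1) by simp
  then obtain C where "\<And>m. nrm ((S ^^ m) f) \<le> C * a ^ m" by (auto simp: E_def)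
  then show ?thesis using symmetric_norm_bound[OF S f a] unfolding a_def by blast
qed

lemma symmetric_quadratic_le_berezin:
  assumes "symmetric_op S" "f \<in> H"
    and "\<And>m. m \<ge> 1 \<Longrightarrow> berezin_number H ip (S ^^ m) \<le> berezin_number H ip S ^ m"
  shows "\<bar>Re (ip (S f) f)\<bar> \<le> berezin_number H ip S * (nrm f)\<^sup>2"
proof -
  have Sf: "S f \<in> H" using assms bops_mem[of S f] by (simp add: symmetric_op_def)
  have "\<bar>Re (ip (S f) f)\<bar> \<le> nrm (S f) * nrm f"
    using abs_Re_le_cmod cauchy_schwarz[OF Sf assms(2)] order_trans by blast
  also have "\<dots> \<le> berezin_number H ip S * nrm f * nrm f"
    using assms by (intro mult_right_mono symmetric_norm_le_berezin) (auto simp: nrm_nonneg)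
  finally show ?thesis by (simp add: power2_eq_square mult.assoc)
qed

end

section \<open>Sectorial operators and the final estimate\<close>

text \<open>Polar form, with sine odd and increasing on [-pi/2, pi/2]; \<theta> < pi/2 keeps the
  argument in that range.\<close>

lemma sector_abs_Im_le:
  assumes "z \<in> sector \<theta>" "\<theta> < pi / 2" shows "\<bar>Im z\<bar> \<le> sin \<theta> * cmod z"
proof -
  have arg: "\<bar>Arg z\<bar> \<le> \<theta>" using assms(1) by (simp add: sector_def)
  have "Im z = cmod z * sin (Arg z)" by (metis Im_rcis rcis_cmod_Arg)
  moreover have "\<bar>sin (Arg z)\<bar> \<le> sin \<theta>"
    using sin_monotone_2pi_le[of "Arg z" \<theta>] sin_monotone_2pi_le[of "- Arg z" \<theta>] arg assms(2)
    by (auto simp: abs_le_iff)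
  ultimately show ?thesis by (simp add: abs_mult mult.commute[of _ "cmod z"] mult_left_mono)
qed

theorem proposition4p11:
  fixes H :: "('x \<Rightarrow> complex) set"
    and ip :: "('x \<Rightarrow> complex) \<Rightarrow> ('x \<Rightarrow> complex) \<Rightarrow> complex"
    and T :: "('x \<Rightarrow> complex) \<Rightarrow> ('x \<Rightarrow> complex)"
    and \<theta> :: real
    and n :: nat
  assumes "rkhs H ip"
    and "0 \<le> \<theta>" and "\<theta> < pi / 2"
    and "T \<in> berezin_sectorial_power H ip \<theta>"
    and "n \<ge> 1"
  shows "berezin_number H ip (T ^^ n)
    \<le> (1 + (sin \<theta>)\<^sup>2) ^ (n - 1) * berezin_number H ip T ^ n"
proof (cases "n = 1")
  case False
  interpret rkhs H ip by fact
  define t where "t = berezin_number H ip T"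
  define s where "s = sin \<theta>"
  define A where "A = real_part H ip T"
  define B where "B = imag_part H ip T"
  have T: "T \<in> bops" and sector: "\<And>l. berezin_transform H ip T l \<in> sector \<theta>"
    and powA: "\<And>m. m \<ge> 1 \<Longrightarrow> berezin_number H ip (A ^^ m) \<le> berezin_number H ip A ^ m"
    and powB: "\<And>m. m \<ge> 1 \<Longrightarrow> berezin_number H ip (B ^^ m) \<le> berezin_number H ip B ^ m"
    using assms(4)
    by (auto simp: berezin_sectorial_power_def berezin_sectorial_def berezin_range_def A_def B_def)
  have s: "s \<ge> 0" using assms(2,3) by (simp add: s_def sin_ge_zero)
  have t: "t \<ge> 0" by (simp add: t_def berezin_number_nonneg T)
  have symA: "symmetric_op A" and symB: "symmetric_op B"
    by (simp_all add: A_def B_def T symmetric_real_part symmetric_imag_part)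
  have "cmod (berezin_transform H ip A l) \<le> t" for l
  proof -
    have "cmod (berezin_transform H ip A l) = \<bar>Re (berezin_transform H ip T l)\<bar>"
      using symmetric_quadratic_real[OF symA nk_mem, of l] quadratic_cartesian(1)[OF T nk_mem, of l]
      by (simp add: berezin_transform_def A_def cmod_eq_Re)
    also have "\<dots> \<le> t"
      unfolding t_def using abs_Re_le_cmod berezin_le_number[OF T] order_trans by blast
    finally show ?thesis .
  qed
  then have berA: "berezin_number H ip A \<le> t" by (rule berezin_number_leI)
  have "cmod (berezin_transform H ip B l) \<le> s * t" for l
  proof -
    have "cmod (berezin_transform H ip B l) = \<bar>Im (berezin_transform H ip T l)\<bar>"
      using symmetric_quadratic_real[OF symB nk_mem, of l] quadratic_cartesian(2)[OF T nk_mem, of l]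
      by (simp add: berezin_transform_def B_def cmod_eq_Re)
    also have "\<dots> \<le> s * cmod (berezin_transform H ip T l)"
      unfolding s_def by (rule sector_abs_Im_le[OF sector assms(3)])
    also have "\<dots> \<le> s * t" unfolding t_def using s by (intro mult_left_mono berezin_le_number T)
    finally show ?thesis .
  qed
  then have berB: "berezin_number H ip B \<le> s * t" by (rule berezin_number_leI)
  \<comment> \<open>The real and imaginary parts of the quadratic form are bounded by
    \<open>t\<close> and \<open>s * t\<close> times the squared norm of \<open>f\<close>;
    \<open>w\<close> is the Euclidean norm of this pair of constants.\<close>
  define w where "w = sqrt (1 + s\<^sup>2) * t"
  have quad: "cmod (ip (T f) f) \<le> w * (nrm f)\<^sup>2" if f: "f \<in> H" for f
  proof -
    have "\<bar>Re (ip (T f) f)\<bar> \<le> t * (nrm f)\<^sup>2"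
      using symmetric_quadratic_le_berezin[OF symA f powA] mult_right_mono[OF berA, of "(nrm f)\<^sup>2"]
        quadratic_cartesian(1)[OF T f] by (simp add: A_def)
    moreover have "\<bar>Im (ip (T f) f)\<bar> \<le> s * t * (nrm f)\<^sup>2"
      using symmetric_quadratic_le_berezin[OF symB f powB] mult_right_mono[OF berB, of "(nrm f)\<^sup>2"]
        quadratic_cartesian(2)[OF T f] by (simp add: B_def)
    ultimately have "(cmod (ip (T f) f))\<^sup>2 \<le> (t * (nrm f)\<^sup>2)\<^sup>2 + (s * t * (nrm f)\<^sup>2)\<^sup>2"
      unfolding cmod_power2 by (intro add_mono) (simp_all add: abs_le_square_iff[symmetric] s t)
    also have "\<dots> = (w * (nrm f)\<^sup>2)\<^sup>2"
      by (simp add: w_def power_mult_distrib algebra_simps)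
    finally show ?thesis by (rule power2_le_imp_le) (simp add: w_def t)
  qed
  have "cmod (berezin_transform H ip (T ^^ n) l) \<le> w ^ n" for l
    using numerical_radius_power[OF T _ assms(5) nk_mem quad, of l] t
    by (simp add: berezin_transform_def nrm_nk w_def)
  then have "berezin_number H ip (T ^^ n) \<le> w ^ n" by (rule berezin_number_leI)
  also have "w ^ n = sqrt (1 + s\<^sup>2) ^ n * t ^ n" by (simp add: w_def power_mult_distrib)
  \<comment> \<open>The case \<open>n = 1\<close> is excluded here: n \<le> 2 (n - 1) requires n
    \<ge> 2. The base is at least 1, so the larger exponent gives the larger power.\<close>
  also have "sqrt (1 + s\<^sup>2) ^ n \<le> sqrt (1 + s\<^sup>2) ^ (2 * (n - 1))"
    using False assms(5) by (intro power_increasing) auto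
  also have "\<dots> = (1 + s\<^sup>2) ^ (n - 1)" by (simp add: power_mult)
  finally show ?thesis using t by (simp add: s_def t_def mult_right_mono)
qed simp

end
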